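(* Let $n\ge 2$. Let $\mathcal{B}_n=\mathcal{B}_n(0)$ be the $n\times n$ matrix whose $(i,j)$ entry ($1\le i,j\le n$) is $\binom{i-1}{j-1}_M B_{i-j,M}$ if $i\ge j$ and $0$ otherwise, and let $\mathcal{Q}_n=(q_{ij})_{1\le i,j\le n}$ be the $n\times n$ matrix with \[q_{ij}=\begin{cases}\dfrac{1}{M_{i-j+1}}\dbinom{i-1}{j-1}_M, & i\ge j,\\ 0, & \text{otherwise.}\end{cases}\] Then $\mathcal{B}_n$ is invertible and $\mathcal{B}_n^{-1}=\mathcal{Q}_n$.
   Context: The Mersenne numbers are $M_n=2^n-1$ ($n\ge 0$). The $M$-factorial is $M_0!=1$, $M_n!=M_nM_{n-1}!$ for $n\ge1$. The $M$-binomial coefficients are $\binom{n}{k}_M=\frac{M_n!}{M_k!M_{n-k}!}$ for $n\ge k\ge 0$ and $\binom nk_M=0$ for $k>n$. The $M$-exponential is $e_M^{xt}=\sum_{n\ge0}x^n\frac{t^n}{M_n!}$. The Mersenne-Bernoulli polynomials $B_{n,M}(x)$ are defined by $\frac{t e_M^{xt}}{e_M^t-1}=\sum_{n\ge0}B_{n,M}(x)\frac{t^n}{M_n!}$ (as power series in $t$), and $B_{n,M}=B_{n,M}(0)$. *)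

theory Defs
  imports
    "HOL-Computational_Algebra.Formal_Power_Series"
    "Jordan_Normal_Form.Matrix"
begin

definition mersenne :: "nat \<Rightarrow> real" where
  "mersenne n = 2 ^ n - 1"

fun M_fact :: "nat \<Rightarrow> real" where
  "M_fact 0 = 1"
| "M_fact (Suc n) = mersenne (Suc n) * M_fact n"

definition M_binomial :: "nat \<Rightarrow> nat \<Rightarrow> real" where
  "M_binomial n k = (if k \<le> n then M_fact n / (M_fact k * M_fact (n - k)) else 0)"

text \<open>\<open>M_exp x\<close> is the formal power series \<open>e_M^(x t)\<close> in the variable \<open>t\<close> (written \<open>fps_X\<close>).\<close>
definition M_exp :: "real \<Rightarrow> real fps" where
  "M_exp x = Abs_fps (\<lambda>n. x ^ n / M_fact n)"

text \<open>
  The denominator below has zero constant term, so \<open>/\<close> is division of formal power series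
  after cancelling one factor \<open>t\<close>; lemma \<open>M_bernoulli_gf_mult\<close> shows that it is exact.
\<close>
definition M_bernoulli_gf :: "real \<Rightarrow> real fps" where
  "M_bernoulli_gf x = fps_X * M_exp x / (M_exp 1 - 1)"

definition M_bernoulli_poly :: "nat \<Rightarrow> real \<Rightarrow> real" where
  "M_bernoulli_poly n x = M_fact n * fps_nth (M_bernoulli_gf x) n"

definition M_bernoulli :: "nat \<Rightarrow> real" where
  "M_bernoulli n = M_bernoulli_poly n 0"

text \<open>
  Matrices are indexed from \<open>0\<close>: the entry at \<open>(i, j)\<close> below is the entry at
  \<open>(i + 1, j + 1)\<close> in the usual numbering from \<open>1\<close>.
\<close>
definition M_bernoulli_mat :: "nat \<Rightarrow> real mat" where
  "M_bernoulli_mat n =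
     mat n n (\<lambda>(i, j). if i \<ge> j then M_binomial i j * M_bernoulli (i - j) else 0)"

definition Q_mat :: "nat \<Rightarrow> real mat" where
  "Q_mat n =
     mat n n (\<lambda>(i, j). if i \<ge> j then 1 / mersenne (i - j + 1) * M_binomial i j else 0)"

lemma M_fact_pos: "M_fact n > 0"
  by (induction n) (auto simp: mersenne_def one_less_power simp del: power_Suc intro!: mult_pos_pos)

lemma M_bernoulli_gf_mult: "M_bernoulli_gf x * (M_exp 1 - 1) = fps_X * M_exp x"
proof -
  have nth0: "fps_nth (M_exp 1 - 1) 0 = 0" and nth1: "fps_nth (M_exp 1 - 1) 1 \<noteq> 0"
    using M_fact_pos[of 1] by (auto simp: M_exp_def simp del: M_fact.simps(2))
  have "subdegree (M_exp 1 - 1) = 1"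
    using nth0 nth1 by (intro subdegreeI) auto
  moreover have "M_exp 1 - 1 \<noteq> 0" using nth1 by auto
  moreover have "fps_nth (fps_X * M_exp x) 1 \<noteq> 0" by (simp add: M_exp_def)
  then have "fps_X * M_exp x \<noteq> 0" by (metis fps_zero_nth)
  moreover from this have "1 \<le> subdegree (fps_X * M_exp x)"
    by (intro subdegree_geI) auto
  ultimately have "(M_exp 1 - 1) dvd (fps_X * M_exp x)"
    by (subst fps_dvd_iff) simp_all
  then show ?thesis
    unfolding M_bernoulli_gf_def by (rule dvd_div_mult_self)
qed

lemma M_bernoulli_poly_gf:
  "Abs_fps (\<lambda>n. M_bernoulli_poly n x / M_fact n) = M_bernoulli_gf x"
proof (rule fps_ext)
  fix n
  show "fps_nth (Abs_fps (\<lambda>n. M_bernoulli_poly n x / M_fact n)) n = fps_nth (M_bernoulli_gf x) n"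
    using M_fact_pos[of n] by (simp add: M_bernoulli_poly_def)
qed

end

theory Submission
  imports Defs
begin

text \<open>
  Conjugating a lower triangular Toeplitz matrix by the diagonal matrix of \<open>M\<close>-factorials gives a
  ring homomorphism from formal power series to matrices. The matrix of Bernoulli numbers is the
  image of \<open>t / (e_M^t - 1)\<close>, and \<open>Q_mat\<close> is the image of \<open>(e_M^t - 1) / t\<close>.
\<close>

definition M_toeplitz :: "nat \<Rightarrow> real fps \<Rightarrow> real mat" where
  "M_toeplitz n f =
     mat n n (\<lambda>(i, j). if j \<le> i then M_fact i / M_fact j * fps_nth f (i - j) else 0)"

lemma M_toeplitz_dim [simp]:
  "dim_row (M_toeplitz n f) = n" "dim_col (M_toeplitz n f) = n"
  by (simp_all add: M_toeplitz_def)

lemma M_fact_nonzero [simp]: "M_fact n \<noteq> 0"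
  using M_fact_pos[of n] by simp

lemma M_toeplitz_one: "M_toeplitz n 1 = 1\<^sub>m n"
  by (rule eq_matI) (auto simp: M_toeplitz_def)

lemma fps_mult_nth_shifted:
  fixes f g :: "'a :: comm_ring_1 fps"
  assumes "j \<le> i"
  shows "(\<Sum>k=j..i. fps_nth f (i - k) * fps_nth g (k - j)) = fps_nth (f * g) (i - j)"
  unfolding fps_mult_nth
  by (rule sum.reindex_bij_witness[of _ "\<lambda>m. i - m" "\<lambda>k. i - k"]) (use assms in auto)

text \<open>The ratios telescope through the summation index: (M_i!/M_k!) (M_k!/M_j!) = M_i!/M_j! is
  independent of k, which leaves a Cauchy product of coefficients.\<close>

lemma M_toeplitz_mult: "M_toeplitz n f * M_toeplitz n g = M_toeplitz n (f * g)"
proof (rule eq_matI)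
  fix i j
  assume "i < dim_row (M_toeplitz n (f * g))" and "j < dim_col (M_toeplitz n (f * g))"
  then have ij: "i < n" "j < n" by simp_all
  have "(M_toeplitz n f * M_toeplitz n g) $$ (i, j) =
      (\<Sum>k<n. M_toeplitz n f $$ (i, k) * M_toeplitz n g $$ (k, j))"
    using ij by (simp add: scalar_prod_def atLeast0LessThan)
  \<comment> \<open>Both factors are lower triangular, so terms outside this range vanish; for j > i
    the range is empty, which gives the zero entry above the diagonal.\<close>
  also have "\<dots> = (\<Sum>k=j..i. M_toeplitz n f $$ (i, k) * M_toeplitz n g $$ (k, j))"
    by (rule sum.mono_neutral_right) (use ij in \<open>auto simp: M_toeplitz_def\<close>)
  also have "\<dots> = (\<Sum>k=j..i. M_fact i / M_fact j * (fps_nth f (i - k) * fps_nth g (k - j)))"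
    by (rule sum.cong) (use ij in \<open>auto simp: M_toeplitz_def\<close>)
  also have "\<dots> = M_fact i / M_fact j * (\<Sum>k=j..i. fps_nth f (i - k) * fps_nth g (k - j))"
    by (simp add: sum_distrib_left)
  also have "\<dots> = M_toeplitz n (f * g) $$ (i, j)"
    using ij by (simp add: M_toeplitz_def fps_mult_nth_shifted)
  finally show "(M_toeplitz n f * M_toeplitz n g) $$ (i, j) = M_toeplitz n (f * g) $$ (i, j)" .
qed simp_all

text \<open>The factor \<open>M_fact (i - j)\<close> carried by the Bernoulli number cancels the one
  in the denominator of the binomial.\<close>

lemma M_bernoulli_mat_toeplitz: "M_bernoulli_mat n = M_toeplitz n (M_bernoulli_gf 0)"
  by (rule eq_matI)
    (auto simp: M_bernoulli_mat_def M_toeplitz_def M_binomial_def M_bernoulli_def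
      M_bernoulli_poly_def)

text \<open>Here \<open>mersenne (i - j + 1)\<close> joins \<open>M_fact (i - j)\<close> in the
  denominator to form the next factorial, hence the index shift in the series.\<close>

lemma Q_mat_toeplitz: "Q_mat n = M_toeplitz n (Abs_fps (\<lambda>k. 1 / M_fact (Suc k)))"
  by (rule eq_matI) (auto simp: Q_mat_def M_toeplitz_def M_binomial_def)

lemma M_bernoulli_gf_inverse: "M_bernoulli_gf 0 * Abs_fps (\<lambda>k. 1 / M_fact (Suc k)) = 1"
proof -
  let ?g = "Abs_fps (\<lambda>k. 1 / M_fact (Suc k))"
  have "M_exp 1 - 1 = fps_X * ?g"
    by (rule fps_ext) (auto simp: M_exp_def fps_X_mult_nth gr0_conv_Suc simp del: M_fact.simps(2))
  \<comment> \<open>Only the constant term survives, since 0 ^ 0 = 1.\<close>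
  moreover have "M_exp 0 = 1"
    by (rule fps_ext) (auto simp: M_exp_def)
  \<comment> \<open>Keeping the factor t on both sides and cancelling it in the integral domain of
    power series avoids dividing by the non-unit e_M^t - 1.\<close>
  ultimately have "fps_X * (M_bernoulli_gf 0 * ?g) = fps_X * 1"
    using M_bernoulli_gf_mult[of 0] by (simp add: mult_ac)
  then show ?thesis
    by (subst (asm) mult_cancel_left) simp
qed

theorem theorem3p1:
  fixes n :: nat
  assumes "n \<ge> 2"
  shows "invertible_mat (M_bernoulli_mat n) \<and>
         inverts_mat (M_bernoulli_mat n) (Q_mat n) \<and>
         inverts_mat (Q_mat n) (M_bernoulli_mat n)"
proof -
  have "inverts_mat (M_bernoulli_mat n) (Q_mat n)"
    by (simp add: inverts_mat_def M_bernoulli_mat_toeplitz Q_mat_toeplitz M_toeplitz_mult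
        M_bernoulli_gf_inverse M_toeplitz_one del: M_fact.simps(2))
  \<comment> \<open>Power series commute, so the same identity also gives the product in the other
    order.\<close>
  moreover have "inverts_mat (Q_mat n) (M_bernoulli_mat n)"
    by (simp add: inverts_mat_def M_bernoulli_mat_toeplitz Q_mat_toeplitz M_toeplitz_mult
        mult.commute[of _ "M_bernoulli_gf 0"] M_bernoulli_gf_inverse M_toeplitz_one del: M_fact.simps(2))
  moreover have "square_mat (M_bernoulli_mat n)"
    by (simp add: M_bernoulli_mat_toeplitz)
  ultimately show ?thesis
    unfolding invertible_mat_def by blast
qed

end
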